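(* Let $(G,C)$ be an edge-colored graph on $n$ vertices. Then $$rt(G)\geq \frac{1}{6}\,\delta^c(G)\,(2\delta^c(G)-n)\,n.$$ In particular, if $\delta^c(G)>cn$ for a real number $c>\frac{1}{2}$, then $$rt(G)\geq\frac{c(2c-1)}{6}n^3.$$
   Context: All graphs are finite, undirected and simple. An edge-colored graph $(G,C)$ is a graph $G$ with an arbitrary function $C:E(G)\to\mathbb{N}$ (not necessarily a proper coloring). The color degree $d^c(v)$ of a vertex $v$ is the number of distinct colors appearing on edges incident with $v$; $\delta^c(G)=\min_{v\in V(G)} d^c(v)$. A triangle is rainbow if its three edges have pairwise distinct colors; $rt(G)$ is the number of rainbow triangles in $G$. *)

theory Defs
  imports Complex_Main
begin

definition finite_simple_graph :: "'a set \<Rightarrow> 'a set set \<Rightarrow> bool" where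
  "finite_simple_graph V E \<longleftrightarrow> finite V \<and> (\<forall>e\<in>E. e \<subseteq> V \<and> card e = 2)"

text \<open>
  An edge colouring is a total function on vertex sets; all notions below only
  look at its values on \<open>E\<close>.
\<close>

definition color_degree :: "'a set set \<Rightarrow> ('a set \<Rightarrow> nat) \<Rightarrow> 'a \<Rightarrow> nat" where
  "color_degree E C v = card (C ` {e \<in> E. v \<in> e})"

text \<open>The value is unspecified if \<open>V = {}\<close>.\<close>

definition min_color_degree :: "'a set \<Rightarrow> 'a set set \<Rightarrow> ('a set \<Rightarrow> nat) \<Rightarrow> nat" where
  "min_color_degree V E C = Min (color_degree E C ` V)"

text \<open>
  Triangles are identified with their vertex sets, so each is counted once.
  The three vertices are distinct since every edge of a simple graph has two elements.
\<close>

definition rainbow_triangles :: "'a set set \<Rightarrow> ('a set \<Rightarrow> nat) \<Rightarrow> 'a set set" where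
  "rainbow_triangles E C =
    {{x, y, z} | x y z.
       {x, y} \<in> E \<and> {y, z} \<in> E \<and> {x, z} \<in> E \<and>
       C {x, y} \<noteq> C {y, z} \<and> C {y, z} \<noteq> C {x, z} \<and> C {x, y} \<noteq> C {x, z}}"

definition rt :: "'a set set \<Rightarrow> ('a set \<Rightarrow> nat) \<Rightarrow> nat" where
  "rt E C = card (rainbow_triangles E C)"

end

theory Submission
  imports Defs
begin

text \<open>
  Write \<open>d v\<close> for the degree and \<open>\<delta>\<close> for the minimum colour degree. A triangle that is not
  rainbow contains a monochromatic cherry, that is, two edges of one colour that share a vertex.
  Hence, counting ordered triples,
  \<open>6 rt \<ge> #(ordered triangles) - 3 #(ordered monochromatic cherries)\<close>,
  and both terms on the right are controlled by degrees:

  \<^item> The ends of an edge \<open>xy\<close> have at least \<open>d x + d y - n\<close> common neighbours, so there are at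
    least \<open>\<Sum>v. 2 (d v)\<^sup>2 - n d v\<close> ordered triangles (\<open>sum_degrees_le_card_ordered_triangles\<close>).
  \<^item> Among the \<open>d v\<close> edges at \<open>v\<close> at least \<open>\<delta>\<close> colours occur. The number of equally coloured
    pairs is largest when a single colour absorbs all \<open>j = d v - \<delta>\<close> repetitions, so \<open>v\<close> is the
    centre of at most \<open>j (j + 1)\<close> ordered monochromatic cherries (\<open>card_collisions_le\<close>).

  The vertex \<open>v\<close> thus contributes at least \<open>2 (d v)\<^sup>2 - n d v - 3 j (j + 1)\<close>, which is
  \<open>\<delta> (2 \<delta> - n)\<close> when \<open>j = 0\<close>, and does not fall below this value for larger degrees \<open>d v < n\<close> when
  \<open>2 \<delta> > n\<close> (\<open>vertex_contribution\<close>). Summing over \<open>v\<close> gives the bound. If \<open>2 \<delta> \<le> n\<close>, the bound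
  is not positive.
\<close>

section \<open>Collisions of a function on a finite set\<close>

text \<open>
  By induction on \<open>A\<close>: a new element with a new value changes neither side. A new element with
  an old value collides with one fibre, and a fibre has at most \<open>j + 1\<close> elements, where
  \<open>j = card A - card (f ` A)\<close>; it adds at most \<open>2 (j + 1) = (j + 2) (j + 1) - (j + 1) j\<close> pairs.
\<close>

lemma card_collisions_le:
  assumes "finite A"
  shows "card {(a, b). a \<in> A \<and> b \<in> A \<and> a \<noteq> b \<and> f a = f b}
           \<le> (card A - card (f ` A) + 1) * (card A - card (f ` A))"
  using assms
proof (induction A)
  case empty
  then show ?case by simp
next
  case (insert x A)
  define P where "P = {(a, b). a \<in> A \<and> b \<in> A \<and> a \<noteq> b \<and> f a = f b}"
  define F where "F = {b \<in> A. f b = f x}"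
  define j where "j = card A - card (f ` A)"
  have finP: "finite P"
    by (rule finite_subset[of _ "A \<times> A"]) (use insert.hyps in \<open>auto simp: P_def\<close>)
  have finF: "finite F" using insert.hyps by (simp add: F_def)
  have im_le: "card (f ` A) \<le> card A" using insert.hyps by (simp add: card_image_le)
  have split: "{(a, b). a \<in> insert x A \<and> b \<in> insert x A \<and> a \<noteq> b \<and> f a = f b}
      = P \<union> (Pair x ` F \<union> (\<lambda>b. (b, x)) ` F)"
    using insert.hyps by (auto simp: P_def F_def)
  have IH: "card P \<le> (j + 1) * j" using insert.IH by (simp add: P_def j_def)
  have le: "card {(a, b). a \<in> insert x A \<and> b \<in> insert x A \<and> a \<noteq> b \<and> f a = f b}
      \<le> card P + (card F + card F)"
    unfolding split
    by (intro order_trans[OF card_Un_le] add_mono card_image_le finF order_refl)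
  show ?case
  proof (cases "f x \<in> f ` A")
    case False
    then have "F = {}" by (auto simp: F_def image_iff)
    moreover have "card (insert x A) - card (f ` insert x A) = j"
      using insert.hyps False by (simp add: j_def)
    ultimately show ?thesis using le IH by simp
  next
    case True
    have im: "f ` insert x A = f ` A" using True by auto
    have "f ` A = insert (f x) (f ` (A - F))" using True by (auto simp: F_def)
    then have "card (f ` A) \<le> Suc (card (f ` (A - F)))"
      using insert.hyps by (simp add: card_insert_if)
    also have "\<dots> \<le> Suc (card (A - F))" using insert.hyps by (simp add: card_image_le)
    also have "card (A - F) = card A - card F"
      by (rule card_Diff_subset) (auto simp: finF, simp add: F_def)
    finally have F: "card F \<le> j + 1"
      using card_mono[of A F] insert.hyps im_le by (auto simp: j_def F_def)
    have "card (insert x A) - card (f ` insert x A) = j + 1"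
      using insert.hyps im im_le by (simp add: j_def)
    then show ?thesis using le IH F by simp
  qed
qed

section \<open>Neighbourhoods, ordered triangles and cherries\<close>

definition neighbors :: "'a set set \<Rightarrow> 'a \<Rightarrow> 'a set" where
  "neighbors E v = {w. {v, w} \<in> E}"

definition ordered_triangles :: "'a set set \<Rightarrow> ('a \<times> 'a \<times> 'a) set" where
  "ordered_triangles E = {(x, y, z). {x, y} \<in> E \<and> {y, z} \<in> E \<and> {x, z} \<in> E}"

definition ordered_rainbow_triangles ::
    "'a set set \<Rightarrow> ('a set \<Rightarrow> nat) \<Rightarrow> ('a \<times> 'a \<times> 'a) set" where
  "ordered_rainbow_triangles E C = {(x, y, z). {x, y} \<in> E \<and> {y, z} \<in> E \<and> {x, z} \<in> E \<and>
     C {x, y} \<noteq> C {y, z} \<and> C {y, z} \<noteq> C {x, z} \<and> C {x, y} \<noteq> C {x, z}}"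

definition monochromatic_cherries ::
    "'a set set \<Rightarrow> ('a set \<Rightarrow> nat) \<Rightarrow> ('a \<times> 'a \<times> 'a) set" where
  "monochromatic_cherries E C =
     {(v, a, b). {v, a} \<in> E \<and> {v, b} \<in> E \<and> a \<noteq> b \<and> C {v, a} = C {v, b}}"

lemma edgeD:
  assumes "finite_simple_graph V E" "{x, y} \<in> E"
  shows "x \<in> V" "y \<in> V" "x \<noteq> y"
  using assms by (auto simp: finite_simple_graph_def)

lemma finite_vertices: "finite_simple_graph V E \<Longrightarrow> finite V"
  by (simp add: finite_simple_graph_def)

lemma neighbors_subset: "finite_simple_graph V E \<Longrightarrow> neighbors E v \<subseteq> V - {v}"
  by (auto simp: neighbors_def dest: edgeD)

lemma finite_neighbors: "finite_simple_graph V E \<Longrightarrow> finite (neighbors E v)"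
  by (rule finite_subset[OF neighbors_subset]) (auto dest: finite_vertices)

lemma finite_ordered_triangles:
  assumes "finite_simple_graph V E"
  shows "finite (ordered_triangles E)"
  by (rule finite_subset[of _ "V \<times> V \<times> V"])
     (use assms in \<open>auto simp: ordered_triangles_def dest: edgeD finite_vertices\<close>)

lemma finite_monochromatic_cherries:
  assumes "finite_simple_graph V E"
  shows "finite (monochromatic_cherries E C)"
  by (rule finite_subset[of _ "V \<times> V \<times> V"])
     (use assms in \<open>auto simp: monochromatic_cherries_def dest: edgeD finite_vertices\<close>)

lemma color_degree_eq_card_image_neighbors:
  assumes "finite_simple_graph V E"
  shows "color_degree E C v = card ((\<lambda>w. C {v, w}) ` neighbors E v)"
proof -
  have "{e \<in> E. v \<in> e} = (\<lambda>w. {v, w}) ` neighbors E v"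
  proof (intro equalityI subsetI)
    fix e assume "e \<in> {e \<in> E. v \<in> e}"
    then have e: "e \<in> E" "v \<in> e" by auto
    then have "card e = 2" using assms by (auto simp: finite_simple_graph_def)
    then obtain a b where "e = {a, b}" by (auto simp: card_2_iff)
    then show "e \<in> (\<lambda>w. {v, w}) ` neighbors E v"
      using e by (auto simp: neighbors_def insert_commute)
  qed (auto simp: neighbors_def)
  then show ?thesis by (simp add: color_degree_def image_image)
qed

section \<open>Counting\<close>

text \<open>Each set of three vertices has only six orderings.\<close>

lemma card_ordered_rainbow_triangles_le:
  assumes G: "finite_simple_graph V E"
  shows "card (ordered_rainbow_triangles E C) \<le> 6 * rt E C"
proof -
  let ?R = "ordered_rainbow_triangles E C"
  let ?orderings = "\<lambda>S. {(x, y, z). S = {x, y, z} \<and> (x, y, z) \<in> ?R}"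
  have "rainbow_triangles E C \<subseteq> Pow V"
    using G by (auto simp: rainbow_triangles_def dest: edgeD)
  then have fin: "finite (rainbow_triangles E C)"
    using finite_vertices[OF G] by (meson finite_Pow_iff finite_subset)
  have orderings: "finite (?orderings S) \<and> card (?orderings S) \<le> 6"
    if "S \<in> rainbow_triangles E C" for S
  proof -
    from that obtain a b c where S: "S = {a, b, c}" unfolding rainbow_triangles_def by blast
    let ?perms = "[(a, b, c), (a, c, b), (b, a, c), (b, c, a), (c, a, b), (c, b, a)]"
    have "(x, y, z) \<in> set ?perms" if "(x, y, z) \<in> ?orderings S" for x y z
    proof -
      have "x \<noteq> y" "y \<noteq> z" "x \<noteq> z"
        using that G by (auto simp: ordered_rainbow_triangles_def dest: edgeD)
      moreover have "{x, y, z} = {a, b, c}" using that S by auto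
      then have "x \<in> {a, b, c}" "y \<in> {a, b, c}" "z \<in> {a, b, c}" by blast+
      ultimately show ?thesis by auto
    qed
    then have sub: "?orderings S \<subseteq> set ?perms" by blast
    have "card (?orderings S) \<le> card (set ?perms)" by (rule card_mono[OF _ sub]) simp
    also have "\<dots> \<le> length ?perms" by (rule card_length)
    finally show ?thesis using finite_subset[OF sub] by simp
  qed
  have "?R \<subseteq> (\<Union>S\<in>rainbow_triangles E C. ?orderings S)"
    by (auto simp: ordered_rainbow_triangles_def rainbow_triangles_def)
  then have "card ?R \<le> card (\<Union>S\<in>rainbow_triangles E C. ?orderings S)"
    by (intro card_mono finite_UN_I fin) (use orderings in auto)
  also have "\<dots> \<le> (\<Sum>S\<in>rainbow_triangles E C. card (?orderings S))"
    by (rule card_UN_le[OF fin])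
  also have "\<dots> \<le> (\<Sum>S\<in>rainbow_triangles E C. 6)"
    by (rule sum_mono) (use orderings in auto)
  finally show ?thesis by (simp add: rt_def)
qed

text \<open>
  A triangle that is not rainbow is a monochromatic cherry centred at its first, second or
  third vertex.
\<close>

lemma card_ordered_triangles_le:
  assumes G: "finite_simple_graph V E"
  shows "card (ordered_triangles E)
           \<le> card (ordered_rainbow_triangles E C) + 3 * card (monochromatic_cherries E C)"
proof -
  let ?R = "ordered_rainbow_triangles E C"
  let ?M = "monochromatic_cherries E C"
  let ?f = "\<lambda>(v, a, b). (a, v, b)"
  let ?g = "\<lambda>(v, a, b). (a, b, v)"
  have finM: "finite ?M" by (rule finite_monochromatic_cherries[OF G])
  have "?R \<subseteq> ordered_triangles E"
    by (auto simp: ordered_rainbow_triangles_def ordered_triangles_def)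
  then have finR: "finite ?R" using finite_ordered_triangles[OF G] finite_subset by blast
  have "t \<in> ?R \<union> (?M \<union> (?f ` ?M \<union> ?g ` ?M))" if t: "t \<in> ordered_triangles E" for t
  proof -
    obtain x y z where xyz: "t = (x, y, z)" by (cases t)
    have e: "{x, y} \<in> E" "{y, z} \<in> E" "{x, z} \<in> E"
      using t by (auto simp: xyz ordered_triangles_def)
    then have ne: "x \<noteq> y" "y \<noteq> z" "x \<noteq> z" using edgeD(3)[OF G] by blast+
    consider "t \<in> ?R" | "C {x, y} = C {x, z}" | "C {x, y} = C {y, z}" | "C {y, z} = C {x, z}"
      using e by (auto simp: xyz ordered_rainbow_triangles_def)
    then show ?thesis
    proof cases
      case 2
      then have "(x, y, z) \<in> ?M" using e ne by (simp add: monochromatic_cherries_def)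
      then show ?thesis by (simp add: xyz)
    next
      case 3
      then have "(y, x, z) \<in> ?M"
        using e ne by (simp add: monochromatic_cherries_def insert_commute)
      then have "?f (y, x, z) \<in> ?f ` ?M" by (rule imageI)
      then show ?thesis by (simp add: xyz)
    next
      case 4
      then have "(z, x, y) \<in> ?M"
        using e ne by (simp add: monochromatic_cherries_def insert_commute)
      then have "?g (z, x, y) \<in> ?g ` ?M" by (rule imageI)
      then show ?thesis by (simp add: xyz)
    qed simp
  qed
  then have "card (ordered_triangles E) \<le> card (?R \<union> (?M \<union> (?f ` ?M \<union> ?g ` ?M)))"
    by (intro card_mono) (use finM finR in auto)
  also have "\<dots> \<le> card ?R + (card ?M + (card ?M + card ?M))"
    by (intro order_trans[OF card_Un_le] add_mono card_image_le finM order_refl)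
  finally show ?thesis by simp
qed

lemma card_monochromatic_cherries_le:
  fixes C :: "'a set \<Rightarrow> nat"
  assumes G: "finite_simple_graph V E"
  defines "j \<equiv> \<lambda>v. card (neighbors E v) - color_degree E C v"
  shows "card (monochromatic_cherries E C) \<le> (\<Sum>v\<in>V. (j v + 1) * j v)"
proof -
  let ?pairs = "\<lambda>v. {(a, b). a \<in> neighbors E v \<and> b \<in> neighbors E v \<and> a \<noteq> b \<and>
                       C {v, a} = C {v, b}}"
  have "monochromatic_cherries E C = Sigma V ?pairs"
    using G by (auto simp: monochromatic_cherries_def neighbors_def dest: edgeD)
  moreover have "finite (?pairs v)" for v
    by (rule finite_subset[of _ "neighbors E v \<times> neighbors E v"])
       (use finite_neighbors[OF G] in auto)
  ultimately have "card (monochromatic_cherries E C) = (\<Sum>v\<in>V. card (?pairs v))"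
    using finite_vertices[OF G] by simp
  also have "\<dots> \<le> (\<Sum>v\<in>V. (j v + 1) * j v)"
    unfolding j_def color_degree_eq_card_image_neighbors[OF G]
    by (intro sum_mono card_collisions_le finite_neighbors[OF G])
  finally show ?thesis .
qed

text \<open>
  Count the triangles over their first edge \<open>xy\<close>, using
  \<open>card (N x \<inter> N y) \<ge> d x + d y - n\<close>. By symmetry, either of \<open>d x\<close> and \<open>d y\<close> adds up to
  \<open>\<Sum>v. (d v)\<^sup>2\<close> over all ordered edges.
\<close>

lemma sum_degrees_le_card_ordered_triangles:
  fixes E :: "'a set set"
  assumes G: "finite_simple_graph V E"
  defines "d \<equiv> \<lambda>v. real (card (neighbors E v))"
  shows "(\<Sum>v\<in>V. 2 * (d v)\<^sup>2 - real (card V) * d v) \<le> real (card (ordered_triangles E))"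
proof -
  let ?N = "neighbors E"
  have finV: "finite V" by (rule finite_vertices[OF G])
  have finN: "finite (?N v)" for v by (rule finite_neighbors[OF G])
  have "ordered_triangles E = Sigma V (\<lambda>x. Sigma (?N x) (\<lambda>y. ?N x \<inter> ?N y))"
    using G by (auto simp: ordered_triangles_def neighbors_def dest: edgeD)
  then have T: "card (ordered_triangles E) = (\<Sum>x\<in>V. \<Sum>y\<in>?N x. card (?N x \<inter> ?N y))"
    using finV finN by simp
  have codeg: "d x + d y - real (card V) \<le> real (card (?N x \<inter> ?N y))" for x y
  proof -
    have "card (?N x) + card (?N y) = card (?N x \<union> ?N y) + card (?N x \<inter> ?N y)"
      by (rule card_Un_Int[OF finN finN])
    moreover have "card (?N x \<union> ?N y) \<le> card V"
      using neighbors_subset[OF G] finV by (intro card_mono) auto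
    ultimately show ?thesis unfolding d_def by linarith
  qed
  have N_eq: "?N x = {y \<in> V. {x, y} \<in> E}" for x
    using G by (auto simp: neighbors_def dest: edgeD)
  have "(\<Sum>x\<in>V. \<Sum>y\<in>?N x. d y) = (\<Sum>y\<in>V. \<Sum>x | x \<in> V \<and> {x, y} \<in> E. d y)"
    unfolding N_eq by (rule sum.swap_restrict[OF finV finV])
  also have "\<dots> = (\<Sum>y\<in>V. \<Sum>x\<in>?N y. d y)"
    unfolding N_eq by (simp add: insert_commute)
  also have "\<dots> = (\<Sum>y\<in>V. (d y)\<^sup>2)" by (simp add: d_def power2_eq_square)
  finally have swap: "(\<Sum>x\<in>V. \<Sum>y\<in>?N x. d y) = (\<Sum>y\<in>V. (d y)\<^sup>2)" .
  have "(\<Sum>x\<in>V. \<Sum>y\<in>?N x. d x + d y - real (card V))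
      = (\<Sum>x\<in>V. d x * d x) + (\<Sum>x\<in>V. \<Sum>y\<in>?N x. d y) - (\<Sum>x\<in>V. d x * real (card V))"
    by (simp add: sum.distrib sum_subtractf d_def)
  also have "\<dots> = (\<Sum>v\<in>V. 2 * (d v)\<^sup>2 - real (card V) * d v)"
    unfolding swap by (simp add: sum.distrib sum_subtractf power2_eq_square mult.commute
        flip: sum_distrib_left)
  finally have "(\<Sum>v\<in>V. 2 * (d v)\<^sup>2 - real (card V) * d v)
      = (\<Sum>x\<in>V. \<Sum>y\<in>?N x. d x + d y - real (card V))" by simp
  also have "\<dots> \<le> (\<Sum>x\<in>V. \<Sum>y\<in>?N x. real (card (?N x \<inter> ?N y)))"
    by (intro sum_mono codeg)
  finally show ?thesis by (simp add: T)
qed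

section \<open>The lower bound\<close>

text \<open>
  Here \<open>d\<close> is the degree and \<open>k\<close> the colour degree of a vertex. Replacing \<open>k\<close> by \<open>\<delta>\<close> only lowers
  the right-hand side. With \<open>j = d - \<delta>\<close>, the two sides then differ by \<open>j (4 \<delta> - j - n - 3)\<close>. Since \<open>j \<le> n - 1 - \<delta>\<close>, the
  second factor is at least \<open>5 \<delta> - 2 n - 2\<close>, which is not negative because \<open>2 \<delta> \<ge> n + 1\<close>.
\<close>

lemma vertex_contribution:
  fixes \<delta> d n k :: nat
  assumes "\<delta> \<le> k" "k \<le> d" "d < n" "n < 2 * \<delta>"
  shows "real \<delta> * (2 * real \<delta> - real n)
           \<le> 2 * (real d)\<^sup>2 - real n * real d - 3 * real ((d - k + 1) * (d - k))"
proof -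
  define j where "j = real d - real \<delta>"
  have "(d - k + 1) * (d - k) \<le> (d - \<delta> + 1) * (d - \<delta>)"
    using assms by (intro mult_mono) auto
  then have "real ((d - k + 1) * (d - k)) \<le> real ((d - \<delta> + 1) * (d - \<delta>))"
    by (simp only: of_nat_le_iff)
  also have "\<dots> = (j + 1) * j"
    using assms unfolding j_def of_nat_mult of_nat_add by (simp add: of_nat_diff)
  finally have collisions: "real ((d - k + 1) * (d - k)) \<le> (j + 1) * j" .
  have "0 \<le> j * (4 * real \<delta> - j - real n - 3)"
    using assms unfolding j_def by (intro mult_nonneg_nonneg) linarith+
  also have "\<dots> = 2 * (real d)\<^sup>2 - real n * real d - 3 * ((j + 1) * j)
                   - real \<delta> * (2 * real \<delta> - real n)"
    unfolding j_def by (simp add: power2_eq_square algebra_simps)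
  finally show ?thesis using collisions by linarith
qed

theorem theorem4:
  fixes V :: "'a set" and E :: "'a set set" and C :: "'a set \<Rightarrow> nat" and n :: nat
  assumes "finite_simple_graph V E" and "card V = n"
  shows "real (rt E C) \<ge>
           1 / 6 * real (min_color_degree V E C)
             * (2 * real (min_color_degree V E C) - real n) * real n
       \<and> (\<forall>c::real. c > 1 / 2 \<longrightarrow> real (min_color_degree V E C) > c * real n
             \<longrightarrow> real (rt E C) \<ge> c * (2 * c - 1) / 6 * real n ^ 3)"
proof -
  note G = assms(1)
  define \<delta> where "\<delta> = min_color_degree V E C"
  let ?d = "\<lambda>v. card (neighbors E v)"
  let ?j = "\<lambda>v. ?d v - color_degree E C v"
  have finV: "finite V" by (rule finite_vertices[OF G])
  have bound: "real \<delta> * (2 * real \<delta> - real n) * real n \<le> 6 * real (rt E C)"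
  proof (cases "n < 2 * \<delta>")
    case False
    then have "real \<delta> * (2 * real \<delta> - real n) \<le> 0"
      by (intro mult_nonneg_nonpos) auto
    then have "real \<delta> * (2 * real \<delta> - real n) * real n \<le> 0"
      by (rule mult_nonpos_nonneg) simp
    then show ?thesis by (smt (verit) of_nat_0_le_iff)
  next
    case True
    have vertex: "real \<delta> * (2 * real \<delta> - real n)
        \<le> 2 * (real (?d v))\<^sup>2 - real n * real (?d v) - 3 * real ((?j v + 1) * ?j v)"
      if v: "v \<in> V" for v
    proof (rule vertex_contribution[OF _ _ _ True])
      show "\<delta> \<le> color_degree E C v"
        unfolding \<delta>_def min_color_degree_def using finV v by (intro Min_le) auto
      show "color_degree E C v \<le> ?d v"
        unfolding color_degree_eq_card_image_neighbors[OF G]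
        by (rule card_image_le[OF finite_neighbors[OF G]])
      have "neighbors E v \<subset> V" using neighbors_subset[OF G] v by blast
      then show "?d v < n" using psubset_card_mono[OF finV] assms(2) by blast
    qed
    have "real \<delta> * (2 * real \<delta> - real n) * real n = (\<Sum>v\<in>V. real \<delta> * (2 * real \<delta> - real n))"
      using assms(2) by simp
    also have "\<dots> \<le> (\<Sum>v\<in>V. 2 * (real (?d v))\<^sup>2 - real n * real (?d v)
                              - 3 * real ((?j v + 1) * ?j v))"
      by (rule sum_mono[OF vertex])
    also have "\<dots> = (\<Sum>v\<in>V. 2 * (real (?d v))\<^sup>2 - real (card V) * real (?d v))
                   - 3 * real (\<Sum>v\<in>V. (?j v + 1) * ?j v)"
      unfolding assms(2) of_nat_sum sum_distrib_left by (rule sum_subtractf)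
    also have "\<dots> \<le> real (card (ordered_triangles E))
                    - 3 * real (card (monochromatic_cherries E C))"
      by (intro diff_mono mult_left_mono sum_degrees_le_card_ordered_triangles[OF G]
          of_nat_mono card_monochromatic_cherries_le[OF G]) simp
    also have "\<dots> \<le> real (card (ordered_rainbow_triangles E C))"
      using card_ordered_triangles_le[OF G, of C] by linarith
    also have "\<dots> \<le> 6 * real (rt E C)"
      using card_ordered_rainbow_triangles_le[OF G, of C] by linarith
    finally show ?thesis .
  qed
  moreover have "c * (2 * c - 1) / 6 * real n ^ 3 \<le> real (rt E C)"
    if c: "c > 1 / 2" "real \<delta> > c * real n" for c :: real
  proof -
    have "0 \<le> (2 * c - 1) * real n" using c(1) by simp
    moreover have "(2 * c - 1) * real n \<le> 2 * real \<delta> - real n"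
      using c(2) by (simp add: algebra_simps)
    ultimately have "c * real n * ((2 * c - 1) * real n) \<le> real \<delta> * (2 * real \<delta> - real n)"
      using c(2) by (intro mult_mono) auto
    then have "c * real n * ((2 * c - 1) * real n) * real n
        \<le> real \<delta> * (2 * real \<delta> - real n) * real n"
      by (rule mult_right_mono) simp
    then have "c * (2 * c - 1) * real n ^ 3 \<le> 6 * real (rt E C)"
      using bound by (simp add: power3_eq_cube mult.assoc mult.left_commute)
    then show ?thesis by simp
  qed
  ultimately show ?thesis unfolding \<delta>_def by simp
qed

end
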